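(* Let $\tau\in\mathbb{R}\setminus\{0,-1,-2,\dots\}$ and let $\hat P=P\Delta^{(\tau)}$ be the product of the Pascal matrix and the fractional difference matrix of order $\tau$. For every $1\le p<\infty$, the sequence space $\ell_p(\hat P)$ is a BK-space with the norm $$\|x\|_{\ell_p(\hat P)}=\|\hat P x\|_{\ell_p}=\Big(\sum_{k}|(\hat P x)_k|^p\Big)^{1/p},$$ and the sequence space $\ell_\infty(\hat P)$ is a BK-space with the norm $$\|x\|_{\ell_\infty(\hat P)}=\|\hat P x\|_{\ell_\infty}=\sup_k|(\hat P x)_k|.$$
   Context: $\omega$ denotes the space of all (real or complex) sequences $x=(x_k)_{k\ge 0}$. For real $a$ and integer $m\ge 0$, the expression $\frac{\Gamma(a+1)}{m!\,\Gamma(a-m+1)}$ is understood as the generalized binomial coefficient $\frac{a(a-1)\cdots(a-m+1)}{m!}$ (equal to $1$ for $m=0$). The matrix $\hat P=(\hat p_{nk})_{n,k\ge0}=P\Delta^{(\tau)}$ is lower triangular with $$\hat p_{nk}=\sum_{i=k}^{n}(-1)^{i-k}\binom{n}{n-i}\frac{\Gamma(\tau+1)}{(i-k)!\,\Gamma(\tau-i+k+1)}\quad(0\le k\le n),\qquad \hat p_{nk}=0\quad (k>n).$$ It is the product of the Pascal matrix $P=(\binom{n}{n-k})_{0\le k\le n}$ and the lower triangular matrix $\Delta^{(\tau)}$ with entries $(-1)^{n-k}\frac{\Gamma(\tau+1)}{(n-k)!\,\Gamma(\tau-n+k+1)}$ for $0\le k\le n$. For $x\in\omega$, $(\hat P x)_n=\sum_{k=0}^n\hat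 p_{nk}x_k$. For $1\le p\le\infty$, $\ell_p(\hat P)=\{x\in\omega:\hat P x\in\ell_p\}$. A BK-space is a linear subspace of $\omega$ equipped with a norm making it a Banach space on which all coordinate functionals $x\mapsto x_k$ are continuous. *)

theory Defs
  imports "HOL-Analysis.Analysis" "HOL-Library.Nonpos_Ints"
begin

text \<open>
  The space of all sequences is the type \<open>nat \<Rightarrow> 'a\<close>. The scalar type ranges over the class
  intersection \<open>{real_normed_field, banach}\<close>, which has \<open>real\<close> and \<open>complex\<close> as instances and, by
  the Gelfand--Mazur theorem, no others up to isomorphism. Linearity and homogeneity of norms are
  with respect to scalars in \<open>'a\<close>, so complex spaces are complex-linear.
\<close>

definition pascal_matrix :: "nat \<Rightarrow> nat \<Rightarrow> real" where
  "pascal_matrix n k = (if k \<le> n then real (n choose (n - k)) else 0)"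

text \<open>
  For real \<open>a\<close>, \<open>a gchoose m\<close> is \<open>a (a - 1) \<dots> (a - m + 1) / m!\<close>, i.e. the quotient
  \<open>\<Gamma>(a + 1) / (m! \<Gamma>(a - m + 1))\<close>, also where the latter has to be read as a limit.
\<close>

definition frac_diff_matrix :: "real \<Rightarrow> nat \<Rightarrow> nat \<Rightarrow> real" where
  "frac_diff_matrix \<tau> n k = (if k \<le> n then (- 1) ^ (n - k) * (\<tau> gchoose (n - k)) else 0)"

text \<open>
  Product and action of lower triangular infinite matrices: as the entries \<open>A n i\<close> with \<open>i > n\<close>
  vanish, the sums over all indices reduce to finite ones.
\<close>

definition tri_mult :: "(nat \<Rightarrow> nat \<Rightarrow> real) \<Rightarrow> (nat \<Rightarrow> nat \<Rightarrow> real) \<Rightarrow> nat \<Rightarrow> nat \<Rightarrow> real" where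
  "tri_mult A B n k = (\<Sum>i\<le>n. A n i * B i k)"

definition tri_apply ::
    "(nat \<Rightarrow> nat \<Rightarrow> real) \<Rightarrow> (nat \<Rightarrow> 'a) \<Rightarrow> nat \<Rightarrow> 'a :: real_normed_field" where
  "tri_apply A x n = (\<Sum>k\<le>n. of_real (A n k) * x k)"

definition P_hat :: "real \<Rightarrow> nat \<Rightarrow> nat \<Rightarrow> real" where
  "P_hat \<tau> = tri_mult pascal_matrix (frac_diff_matrix \<tau>)"

lemma P_hat_entry:
  assumes "k \<le> n"
  shows "P_hat \<tau> n k =
    (\<Sum>i=k..n. (- 1) ^ (i - k) * real (n choose (n - i)) * (\<tau> gchoose (i - k)))"
proof -
  have "P_hat \<tau> n k = (\<Sum>i\<le>n. pascal_matrix n i * frac_diff_matrix \<tau> i k)"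
    by (simp add: P_hat_def tri_mult_def)
  also have "\<dots> = (\<Sum>i=k..n. pascal_matrix n i * frac_diff_matrix \<tau> i k)"
    by (rule sum.mono_neutral_right) (auto simp: frac_diff_matrix_def)
  also have "\<dots> = (\<Sum>i=k..n. (- 1) ^ (i - k) * real (n choose (n - i)) * (\<tau> gchoose (i - k)))"
    by (rule sum.cong) (auto simp: pascal_matrix_def frac_diff_matrix_def)
  finally show ?thesis .
qed

lemma P_hat_upper: "n < k \<Longrightarrow> P_hat \<tau> n k = 0"
  by (auto simp: P_hat_def tri_mult_def frac_diff_matrix_def intro!: sum.neutral)

definition lp_space :: "real \<Rightarrow> (nat \<Rightarrow> 'a :: real_normed_vector) set" where
  "lp_space p = {x. summable (\<lambda>k. norm (x k) powr p)}"

definition lp_norm :: "real \<Rightarrow> (nat \<Rightarrow> 'a :: real_normed_vector) \<Rightarrow> real" where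
  "lp_norm p x = (\<Sum>k. norm (x k) powr p) powr (1 / p)"

definition linf_space :: "(nat \<Rightarrow> 'a :: real_normed_vector) set" where
  "linf_space = {x. bounded (range x)}"

definition linf_norm :: "(nat \<Rightarrow> 'a :: real_normed_vector) \<Rightarrow> real" where
  "linf_norm x = (SUP k. norm (x k))"

definition matrix_domain ::
    "(nat \<Rightarrow> nat \<Rightarrow> real) \<Rightarrow> (nat \<Rightarrow> 'a) set \<Rightarrow> (nat \<Rightarrow> 'a :: real_normed_field) set" where
  "matrix_domain A X = {x. tri_apply A x \<in> X}"

definition seq_subspace :: "(nat \<Rightarrow> 'a :: real_normed_field) set \<Rightarrow> bool" where
  "seq_subspace X \<longleftrightarrow>
     (\<lambda>k. 0) \<in> X \<and>
     (\<forall>x\<in>X. \<forall>y\<in>X. (\<lambda>k. x k + y k) \<in> X) \<and>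
     (\<forall>c. \<forall>x\<in>X. (\<lambda>k. c * x k) \<in> X)"

definition seq_norm_on ::
    "(nat \<Rightarrow> 'a :: real_normed_field) set \<Rightarrow> ((nat \<Rightarrow> 'a) \<Rightarrow> real) \<Rightarrow> bool" where
  "seq_norm_on X N \<longleftrightarrow>
     (\<forall>x\<in>X. 0 \<le> N x) \<and>
     (\<forall>x\<in>X. N x = 0 \<longleftrightarrow> x = (\<lambda>k. 0)) \<and>
     (\<forall>c. \<forall>x\<in>X. N (\<lambda>k. c * x k) = norm c * N x) \<and>
     (\<forall>x\<in>X. \<forall>y\<in>X. N (\<lambda>k. x k + y k) \<le> N x + N y)"

text \<open>
  The value 0 off \<open>X\<close> is a dummy: the locale \<^locale>\<open>Metric_space\<close> requires nonnegativity and
  symmetry of the distance on the whole type, while a norm on \<open>X\<close> is only meaningful on \<open>X\<close>.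
\<close>

definition norm_dist ::
    "(nat \<Rightarrow> 'a :: real_normed_field) set \<Rightarrow> ((nat \<Rightarrow> 'a) \<Rightarrow> real) \<Rightarrow>
     (nat \<Rightarrow> 'a) \<Rightarrow> (nat \<Rightarrow> 'a) \<Rightarrow> real" where
  "norm_dist X N x y = (if x \<in> X \<and> y \<in> X then N (\<lambda>k. x k - y k) else 0)"

lemma Metric_space_norm_dist:
  assumes X: "seq_subspace X" and N: "seq_norm_on X N"
  shows "Metric_space X (norm_dist X N)"
proof -
  have add: "(\<lambda>k. x k + y k) \<in> X" if "x \<in> X" "y \<in> X" for x y
    using X that by (simp add: seq_subspace_def)
  have scale: "(\<lambda>k. c * x k) \<in> X" if "x \<in> X" for c x
    using X that by (simp add: seq_subspace_def)
  have hom: "N (\<lambda>k. c * x k) = norm c * N x" if "x \<in> X" for c x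
    using N that by (simp add: seq_norm_on_def)
  have tri: "N (\<lambda>k. x k + y k) \<le> N x + N y" if "x \<in> X" "y \<in> X" for x y
    using N that by (simp add: seq_norm_on_def)
  have diff: "(\<lambda>k. x k - y k) \<in> X" if "x \<in> X" "y \<in> X" for x y
    using add[OF that(1) scale[OF that(2), of "- 1"]] by simp
  have comm: "N (\<lambda>k. x k - y k) = N (\<lambda>k. y k - x k)" if "x \<in> X" "y \<in> X" for x y
    using hom[OF diff[OF that(2,1)], of "- 1"] by simp
  show ?thesis
  proof
    show "0 \<le> norm_dist X N x y" for x y
      using N diff by (simp add: norm_dist_def seq_norm_on_def)
    show "norm_dist X N x y = norm_dist X N y x" for x y
      using comm[of x y] by (auto simp: norm_dist_def)
    show "norm_dist X N x y = 0 \<longleftrightarrow> x = y" if "x \<in> X" "y \<in> X" for x y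
      using N diff[OF that] that by (simp add: norm_dist_def seq_norm_on_def fun_eq_iff)
    show "norm_dist X N x z \<le> norm_dist X N x y + norm_dist X N y z"
      if "x \<in> X" "y \<in> X" "z \<in> X" for x y z
      using tri[OF diff[OF that(1,2)] diff[OF that(2,3)]] that by (simp add: norm_dist_def)
  qed
qed

definition BK_space ::
    "(nat \<Rightarrow> 'a :: real_normed_field) set \<Rightarrow> ((nat \<Rightarrow> 'a) \<Rightarrow> real) \<Rightarrow> bool" where
  "BK_space X N \<longleftrightarrow>
     seq_subspace X \<and> seq_norm_on X N \<and>
     Metric_space.mcomplete X (norm_dist X N) \<and>
     (\<forall>k. continuous_map (Metric_space.mtopology X (norm_dist X N)) euclidean (\<lambda>x. x k))"

end

theory Submission
  imports Defs
begin

text \<open>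
  Coordinate functionals are bounded and closed norm balls are closed under coordinatewise
  convergence, both for the \<open>\<ell>\<^sub>p\<close> norms and, since a triangle with nonzero diagonal acts by finite
  sums and can be solved coordinate by coordinate, for their pullbacks along such a triangle. These
  two properties alone make a normed sequence space BK: a Cauchy sequence converges
  coordinatewise, and the ball property puts the limit into the space and turns the Cauchy
  estimate into convergence in norm. The matrix \<open>P_hat \<tau>\<close> is such a triangle because its diagonal
  entries are 1.
\<close>

section \<open>Bounded coordinates and coordinatewise closed balls give a BK-space\<close>

definition bounded_coords ::
    "(nat \<Rightarrow> 'a :: real_normed_field) set \<Rightarrow> ((nat \<Rightarrow> 'a) \<Rightarrow> real) \<Rightarrow> bool" where
  "bounded_coords X N \<longleftrightarrow> (\<forall>k. \<exists>C. \<forall>x\<in>X. norm (x k) \<le> C * N x)"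

text \<open>This is a Fatou property of the norm: the bound \<open>B\<close> is uniform in
  \<open>n\<close>, while convergence is only assumed in each coordinate, not in
  \<open>N\<close>.\<close>

definition balls_coordwise_closed ::
    "(nat \<Rightarrow> 'a :: real_normed_field) set \<Rightarrow> ((nat \<Rightarrow> 'a) \<Rightarrow> real) \<Rightarrow> bool" where
  "balls_coordwise_closed X N \<longleftrightarrow>
     (\<forall>f x B. (\<forall>n. f n \<in> X \<and> N (f n) \<le> B) \<longrightarrow> (\<forall>k. (\<lambda>n. f n k) \<longlonglongrightarrow> x k) \<longrightarrow> x \<in> X \<and> N x \<le> B)"

lemma seq_subspace_diff:
  assumes "seq_subspace X" "x \<in> X" "y \<in> X"
  shows "(\<lambda>k. x k - y k) \<in> X"
proof -
  have add: "(\<lambda>k. x k + z k) \<in> X" if "z \<in> X" for z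
    using assms that by (simp add: seq_subspace_def)
  have "(\<lambda>k. - 1 * y k) \<in> X"
    using assms unfolding seq_subspace_def by blast
  from add[OF this] show ?thesis by simp
qed

text \<open>Since \<open>N\<close> is nonnegative on \<open>X\<close>, the constant can be enlarged
  to \<open>max C 1\<close>. Positivity permits radii of the form \<open>e / C\<close> in the
  epsilon arguments.\<close>

lemma bounded_coordsE:
  assumes "bounded_coords X N" "seq_norm_on X N"
  obtains C where "C > 0" "\<And>x. x \<in> X \<Longrightarrow> norm (x k) \<le> C * N x"
proof -
  obtain C where C: "\<And>x. x \<in> X \<Longrightarrow> norm (x k) \<le> C * N x"
    using assms(1) unfolding bounded_coords_def by blast
  have "norm (x k) \<le> max C 1 * N x" if "x \<in> X" for x
    by (rule order_trans[OF C[OF that] mult_right_mono])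
      (use assms(2) that in \<open>auto simp: seq_norm_on_def\<close>)
  then show thesis
    by (intro that[of "max C 1"]) auto
qed

lemma BK_spaceI:
  fixes X :: "(nat \<Rightarrow> 'a :: {real_normed_field, banach}) set"
  assumes X: "seq_subspace X" and N: "seq_norm_on X N"
    and bc: "bounded_coords X N" and cl: "balls_coordwise_closed X N"
  shows "BK_space X N"
proof -
  interpret M: Metric_space X "norm_dist X N"
    by (rule Metric_space_norm_dist[OF X N])
  have "\<exists>x. limitin M.mtopology f x sequentially" if f: "M.MCauchy f" for f
  proof -
    have fX: "f n \<in> X" for n
      using f unfolding M.MCauchy_def by blast
    have dX: "(\<lambda>k. f m k - f n k) \<in> X" for m n
      by (rule seq_subspace_diff[OF X fX fX])
    \<comment> \<open>All terms lie in \<open>X\<close>, so \<open>norm_dist\<close> is the norm of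
      the difference here and never the dummy value 0.\<close>
    have f_cauchy: "\<exists>L. \<forall>m n. L \<le> m \<longrightarrow> L \<le> n \<longrightarrow> N (\<lambda>k. f m k - f n k) < e" if "e > 0" for e
      using f that fX unfolding M.MCauchy_def norm_dist_def by simp
    have "Cauchy (\<lambda>n. f n k)" for k
    proof (rule metric_CauchyI)
      fix e :: real assume "e > 0"
      obtain C where C: "C > 0" "\<And>x. x \<in> X \<Longrightarrow> norm (x k) \<le> C * N x"
        using bounded_coordsE[OF bc N] by blast
      obtain L where L: "\<And>m n. L \<le> m \<Longrightarrow> L \<le> n \<Longrightarrow> N (\<lambda>k. f m k - f n k) < e / C"
        using f_cauchy[of "e / C"] \<open>e > 0\<close> C(1) by auto
      have "dist (f m k) (f n k) < e" if "L \<le> m" "L \<le> n" for m n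
      proof -
        have "norm (f m k - f n k) \<le> C * N (\<lambda>k. f m k - f n k)"
          using C(2)[OF dX] .
        also have "\<dots> < e"
          using L[OF that] C(1) by (simp add: field_simps)
        finally show ?thesis by (simp add: dist_norm)
      qed
      then show "\<exists>L. \<forall>m\<ge>L. \<forall>n\<ge>L. dist (f m k) (f n k) < e" by blast
    qed
    then have "\<forall>k. \<exists>l. (\<lambda>n. f n k) \<longlonglongrightarrow> l"
      by (simp add: Cauchy_convergent_iff convergent_def)
    then obtain x where x: "\<And>k. (\<lambda>n. f n k) \<longlonglongrightarrow> x k"
      by metis
    \<comment> \<open>Fix \<open>m\<close> and let the second index tend to infinity. Starting that
      index at \<open>L\<close> puts every difference in the ball of radius \<open>e\<close>, so the
      ball property applies to the limit; strict bounds become weak ones.\<close>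
    have lim: "(\<lambda>k. f m k - x k) \<in> X \<and> N (\<lambda>k. f m k - x k) \<le> e"
      if L: "\<And>m n. L \<le> m \<Longrightarrow> L \<le> n \<Longrightarrow> N (\<lambda>k. f m k - f n k) < e" and m: "L \<le> m" for e L m
    proof -
      have "\<forall>n. (\<lambda>k. f m k - f (n + L) k) \<in> X \<and> N (\<lambda>k. f m k - f (n + L) k) \<le> e"
        using dX L[OF m] by (simp add: less_imp_le)
      moreover have "\<forall>k. (\<lambda>n. f m k - f (n + L) k) \<longlonglongrightarrow> f m k - x k"
        by (intro allI tendsto_intros LIMSEQ_ignore_initial_segment x)
      ultimately show ?thesis
        using cl[unfolded balls_coordwise_closed_def, rule_format,
            of "\<lambda>n k. f m k - f (n + L) k" e "\<lambda>k. f m k - x k"] by blast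
    qed
    have xX: "x \<in> X"
    proof -
      \<comment> \<open>Radius 1 is arbitrary: a single difference \<open>f L - x\<close> in
        \<open>X\<close> suffices, because \<open>x\<close> is \<open>f L\<close> minus it.\<close>
      obtain L where L: "\<And>m n. L \<le> m \<Longrightarrow> L \<le> n \<Longrightarrow> N (\<lambda>k. f m k - f n k) < 1"
        using f_cauchy[of 1] by auto
      then have "(\<lambda>k. f L k - x k) \<in> X"
        using lim by blast
      from seq_subspace_diff[OF X fX[of L] this] show ?thesis by simp
    qed
    have "\<exists>L. \<forall>n\<ge>L. f n \<in> X \<and> norm_dist X N (f n) x < e" if "e > 0" for e
    proof -
      \<comment> \<open>Halving \<open>e\<close> restores the strict inequality that is lost in the
        limit.\<close>
      obtain L where L: "\<And>m n. L \<le> m \<Longrightarrow> L \<le> n \<Longrightarrow> N (\<lambda>k. f m k - f n k) < e / 2"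
        using f_cauchy[of "e / 2"] \<open>e > 0\<close> by auto
      have "norm_dist X N (f n) x < e" if "L \<le> n" for n
        using lim[OF L that] fX xX \<open>e > 0\<close> by (simp add: norm_dist_def)
      then show ?thesis using fX by blast
    qed
    then show ?thesis
      using xX by (auto simp: M.limit_metric_sequentially)
  qed
  then have "M.mcomplete"
    by (simp add: M.mcomplete_def)
  moreover have "continuous_map M.mtopology euclidean (\<lambda>x. x k)" for k
  proof -
    obtain C where C: "C > 0" "\<And>x. x \<in> X \<Longrightarrow> norm (x k) \<le> C * N x"
      using bounded_coordsE[OF bc N] by blast
    have "openin M.mtopology {x \<in> X. x k \<in> U}" if U: "open U" for U
    proof -
      have "\<exists>r>0. M.mball x r \<subseteq> {x \<in> X. x k \<in> U}" if x: "x \<in> X" "x k \<in> U" for x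
      proof -
        obtain e where e: "e > 0" "\<And>z. dist z (x k) < e \<Longrightarrow> z \<in> U"
          using U x(2) unfolding open_dist by blast
        have "y k \<in> U" if y: "y \<in> X" "norm_dist X N x y < e / C" for y
        proof (rule e(2))
          have "norm (x k - y k) \<le> C * N (\<lambda>k. x k - y k)"
            using C(2)[OF seq_subspace_diff[OF X x(1) y(1)]] .
          also have "\<dots> < e"
            using y x C(1) by (simp add: norm_dist_def field_simps)
          finally show "dist (y k) (x k) < e" by (simp add: dist_norm norm_minus_commute)
        qed
        then have "M.mball x (e / C) \<subseteq> {x \<in> X. x k \<in> U}"
          by (auto simp: M.in_mball)
        then show ?thesis using e(1) C(1) by (intro exI[of _ "e / C"]) simp
      qed
      then show ?thesis
        by (auto simp: M.openin_mtopology)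
    qed
    then show ?thesis
      by (simp add: continuous_map_def)
  qed
  ultimately show ?thesis
    using X N by (simp add: BK_space_def)
qed

section \<open>Triangles: forward substitution and pullback of the norm properties\<close>

lemma tri_apply_zero: "tri_apply A (\<lambda>k. 0) = (\<lambda>k. 0)"
  by (simp add: tri_apply_def fun_eq_iff)

lemma tri_apply_add: "tri_apply A (\<lambda>k. x k + y k) = (\<lambda>k. tri_apply A x k + tri_apply A y k)"
  by (simp add: tri_apply_def fun_eq_iff algebra_simps sum.distrib)

lemma tri_apply_mult: "tri_apply A (\<lambda>k. c * x k) = (\<lambda>k. c * tri_apply A x k)"
  by (simp add: tri_apply_def fun_eq_iff sum_distrib_left mult.left_commute)

lemma tri_apply_tendsto:
  assumes "\<And>k. (\<lambda>n. f n k) \<longlonglongrightarrow> x k"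
  shows "(\<lambda>n. tri_apply A (f n) k) \<longlonglongrightarrow> tri_apply A x k"
  unfolding tri_apply_def by (intro tendsto_intros assms)

text \<open>One step of forward substitution: row \<open>k\<close> involves only
  \<open>x 0, ..., x k\<close>, and splitting off its diagonal term isolates
  \<open>x k\<close>.\<close>

lemma tri_apply_solve:
  assumes "A k k \<noteq> 0"
  shows "x k = (tri_apply A x k - (\<Sum>j<k. of_real (A k j) * x j)) / of_real (A k k)"
proof -
  have "tri_apply A x k = (\<Sum>j<k. of_real (A k j) * x j) + of_real (A k k) * x k"
    unfolding tri_apply_def lessThan_Suc_atMost[symmetric] by (rule sum.lessThan_Suc)
  then show ?thesis using assms by simp
qed

text \<open>Forward substitution gives a trivial kernel, which is what makes the pulled-back norm
  definite.\<close>

lemma tri_apply_eq_zero: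
  assumes diag: "\<And>n. A n n \<noteq> 0" and x: "tri_apply A x = (\<lambda>k. 0)"
  shows "x = (\<lambda>k. 0)"
proof
  show "x k = 0" for k
  proof (induction k rule: less_induct)
    case (less k)
    show ?case
      using tri_apply_solve[where A = A and x = x and k = k, OF diag] by (simp add: x less)
  qed
qed

lemma seq_subspace_matrix_domain:
  assumes "seq_subspace X"
  shows "seq_subspace (matrix_domain A X)"
  using assms
  by (simp add: seq_subspace_def matrix_domain_def tri_apply_zero tri_apply_add tri_apply_mult)

lemma seq_norm_on_matrix_domain:
  assumes diag: "\<And>n. A n n \<noteq> 0" and N: "seq_norm_on X N"
  shows "seq_norm_on (matrix_domain A X) (\<lambda>x. N (tri_apply A x))"
proof -
  have "N (tri_apply A x) = 0 \<longleftrightarrow> x = (\<lambda>k. 0)" if "tri_apply A x \<in> X" for x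
  proof -
    have "N (tri_apply A x) = 0 \<longleftrightarrow> tri_apply A x = (\<lambda>k. 0)"
      using N that unfolding seq_norm_on_def by blast
    also have "\<dots> \<longleftrightarrow> x = (\<lambda>k. 0)"
      using tri_apply_eq_zero[where A = A and x = x, OF diag] tri_apply_zero[of A] by blast
    finally show ?thesis .
  qed
  then show ?thesis
    using N by (simp add: seq_norm_on_def matrix_domain_def tri_apply_add tri_apply_mult)
qed

text \<open>Strong induction along forward substitution: \<open>x k\<close> is a combination of
  coordinate \<open>k\<close> of the image, which is controlled in \<open>X\<close>, and of finitely
  many earlier coordinates, which the induction hypothesis controls.\<close>

lemma bounded_coords_matrix_domain:
  assumes diag: "\<And>n. A n n \<noteq> 0" and bc: "bounded_coords X N"
  shows "bounded_coords (matrix_domain A X) (\<lambda>x. N (tri_apply A x))"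
  unfolding bounded_coords_def
proof
  show "\<exists>C. \<forall>x\<in>matrix_domain A X. norm (x k) \<le> C * N (tri_apply A x)" for k
  proof (induction k rule: less_induct)
    case (less k)
    then have "\<forall>j\<in>{..<k}. \<exists>C. \<forall>x\<in>matrix_domain A X. norm (x j) \<le> C * N (tri_apply A x)"
      by simp
    then obtain C where C: "\<And>j x. j < k \<Longrightarrow> x \<in> matrix_domain A X \<Longrightarrow>
        norm (x j) \<le> C j * N (tri_apply A x)"
      by (metis lessThan_iff)
    obtain D where D: "\<And>y. y \<in> X \<Longrightarrow> norm (y k) \<le> D * N y"
      using bc unfolding bounded_coords_def by blast
    \<comment> \<open>\<open>D\<close> bounds coordinate \<open>k\<close> on \<open>X\<close>, the
      \<open>C j\<close> bound the earlier coordinates of \<open>x\<close>, and the final division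
      is by the diagonal entry.\<close>
    have "norm (x k) \<le> (D + (\<Sum>j<k. \<bar>A k j\<bar> * C j)) / \<bar>A k k\<bar> * N (tri_apply A x)"
      if x: "x \<in> matrix_domain A X" for x
    proof -
      have "norm (tri_apply A x k - (\<Sum>j<k. of_real (A k j) * x j))
          \<le> norm (tri_apply A x k) + (\<Sum>j<k. norm (of_real (A k j) * x j))"
        by (intro order_trans[OF norm_triangle_ineq4] add_left_mono norm_sum)
      also have "\<dots> \<le> D * N (tri_apply A x) + (\<Sum>j<k. \<bar>A k j\<bar> * (C j * N (tri_apply A x)))"
        using D x C by (intro add_mono sum_mono)
          (auto simp: norm_mult matrix_domain_def intro!: mult_left_mono)
      also have "\<dots> = (D + (\<Sum>j<k. \<bar>A k j\<bar> * C j)) * N (tri_apply A x)"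
        by (simp add: algebra_simps sum_distrib_left)
      finally show ?thesis
        using tri_apply_solve[where A = A and x = x and k = k, OF diag]
        by (simp add: norm_divide divide_right_mono)
    qed
    then show ?case by blast
  qed
qed

text \<open>Rows act as finite sums, so coordinatewise convergence of \<open>f n\<close> passes to
  the images, where the ball property of \<open>X\<close> applies.\<close>

lemma balls_coordwise_closed_matrix_domain:
  assumes cl: "balls_coordwise_closed X N"
  shows "balls_coordwise_closed (matrix_domain A X) (\<lambda>x. N (tri_apply A x))"
  unfolding balls_coordwise_closed_def
proof (intro allI impI)
  fix f x B
  assume f: "\<forall>n. f n \<in> matrix_domain A X \<and> N (tri_apply A (f n)) \<le> B"
    and x: "\<forall>k. (\<lambda>n. f n k) \<longlonglongrightarrow> x k"
  have "tri_apply A x \<in> X \<and> N (tri_apply A x) \<le> B"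
    using cl[unfolded balls_coordwise_closed_def, rule_format,
        of "\<lambda>n. tri_apply A (f n)" B "tri_apply A x"] f x
    by (simp add: matrix_domain_def tri_apply_tendsto)
  then show "x \<in> matrix_domain A X \<and> N (tri_apply A x) \<le> B"
    by (simp add: matrix_domain_def)
qed

lemma BK_space_matrix_domain:
  fixes X :: "(nat \<Rightarrow> 'a :: {real_normed_field, banach}) set"
  assumes "\<And>n. A n n \<noteq> 0"
    and "seq_subspace X" "seq_norm_on X N" "bounded_coords X N" "balls_coordwise_closed X N"
  shows "BK_space (matrix_domain A X) (\<lambda>x. N (tri_apply A x))"
  using assms
  by (intro BK_spaceI seq_subspace_matrix_domain seq_norm_on_matrix_domain
      bounded_coords_matrix_domain balls_coordwise_closed_matrix_domain)

text \<open>On the diagonal the sum for the entry has the single index \<open>i = n\<close>, and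
  both binomial coefficients have lower argument 0.\<close>

lemma P_hat_diag: "P_hat \<tau> n n = 1"
  by (simp add: P_hat_entry)

section \<open>Bounded sequences with the supremum norm\<close>

lemma norm_le_linf_norm: "x \<in> linf_space \<Longrightarrow> norm (x k) \<le> linf_norm x"
  unfolding linf_space_def linf_norm_def
  by (rule cSUP_upper) (simp_all add: bdd_above_norm[symmetric] image_image)

lemma linf_norm_le: "(\<And>k. norm (x k) \<le> B) \<Longrightarrow> linf_norm x \<le> B"
  unfolding linf_norm_def by (intro cSUP_least) auto

lemma linf_spaceI: "(\<And>k. norm (x k) \<le> B) \<Longrightarrow> x \<in> linf_space"
  unfolding linf_space_def by (auto simp: bounded_iff)

lemma zero_in_linf_space: "(\<lambda>k. 0) \<in> linf_space"
  by (rule linf_spaceI[of _ 0]) simp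

lemma norm_add_le_linf:
  "x \<in> linf_space \<Longrightarrow> y \<in> linf_space \<Longrightarrow> norm (x k + y k) \<le> linf_norm x + linf_norm y"
  by (intro order_trans[OF norm_triangle_ineq] add_mono norm_le_linf_norm)

lemma norm_mult_le_linf:
  fixes x :: "nat \<Rightarrow> 'a :: real_normed_field"
  shows "x \<in> linf_space \<Longrightarrow> norm (c * x k) \<le> norm c * linf_norm x"
  by (simp add: norm_mult mult_left_mono norm_le_linf_norm)

lemma seq_subspace_linf: "seq_subspace linf_space"
  unfolding seq_subspace_def
  by (intro conjI ballI allI zero_in_linf_space; rule linf_spaceI)
    (assumption | rule norm_add_le_linf norm_mult_le_linf)+

lemma seq_norm_on_linf:
  "seq_norm_on (linf_space :: (nat \<Rightarrow> 'a :: real_normed_field) set) linf_norm"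
  unfolding seq_norm_on_def
proof (intro conjI ballI allI)
  fix x y :: "nat \<Rightarrow> 'a" and c :: 'a
  assume x: "x \<in> linf_space"
  show "0 \<le> linf_norm x"
    using order_trans[OF norm_ge_zero norm_le_linf_norm[OF x]] .
  show "linf_norm x = 0 \<longleftrightarrow> x = (\<lambda>k. 0)"
  proof
    assume "linf_norm x = 0"
    then have "norm (x k) \<le> 0" for k
      using norm_le_linf_norm[OF x, of k] by simp
    then show "x = (\<lambda>k. 0)" by (simp add: fun_eq_iff)
  qed (simp add: linf_norm_def)
  show "linf_norm (\<lambda>k. c * x k) = norm c * linf_norm x"
  proof (cases "c = 0")
    case False
    have cx: "(\<lambda>k. c * x k) \<in> linf_space"
      using norm_mult_le_linf[OF x] by (rule linf_spaceI)
    \<comment> \<open>The lower bound comes from undoing the scaling by \<open>c\<close>, which is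
      why \<open>c = 0\<close> is a separate case.\<close>
    have "norm (x k) \<le> linf_norm (\<lambda>k. c * x k) / norm c" for k
      using norm_le_linf_norm[OF cx, of k] False by (simp add: norm_mult field_simps)
    then have "linf_norm x \<le> linf_norm (\<lambda>k. c * x k) / norm c"
      by (rule linf_norm_le)
    then have "norm c * linf_norm x \<le> linf_norm (\<lambda>k. c * x k)"
      using False by (simp add: field_simps)
    moreover have "linf_norm (\<lambda>k. c * x k) \<le> norm c * linf_norm x"
      using norm_mult_le_linf[OF x] by (rule linf_norm_le)
    ultimately show ?thesis by simp
  qed (simp add: linf_norm_def)
  show "linf_norm (\<lambda>k. x k + y k) \<le> linf_norm x + linf_norm y" if "y \<in> linf_space"
    using norm_add_le_linf[OF x that] by (rule linf_norm_le)
qed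

lemma bounded_coords_linf: "bounded_coords linf_space linf_norm"
  unfolding bounded_coords_def by (intro allI exI[of _ 1]) (simp add: norm_le_linf_norm)

lemma balls_coordwise_closed_linf: "balls_coordwise_closed linf_space linf_norm"
  unfolding balls_coordwise_closed_def
proof (intro allI impI)
  fix f and x :: "nat \<Rightarrow> 'a" and B
  assume f: "\<forall>n. f n \<in> linf_space \<and> linf_norm (f n) \<le> B"
    and x: "\<forall>k. (\<lambda>n. f n k) \<longlonglongrightarrow> x k"
  have "norm (f n k) \<le> B" for n k
    using f norm_le_linf_norm[of "f n" k] by (meson order_trans)
  then have "norm (x k) \<le> B" for k
    using x by (intro LIMSEQ_le_const2[OF tendsto_norm, of "\<lambda>n. f n k"]) auto
  then show "x \<in> linf_space \<and> linf_norm x \<le> B"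
    using linf_spaceI[of x B] linf_norm_le[of x B] by simp
qed

section \<open>The \<open>\<ell>\<^sub>p\<close> norm and partial sums\<close>

lemma lp_norm_nonneg: "0 \<le> lp_norm p x"
  by (simp add: lp_norm_def)

lemma lp_norm_powr:
  assumes "1 \<le> p" "x \<in> lp_space p"
  shows "lp_norm p x powr p = (\<Sum>k. norm (x k) powr p)"
  using assms by (simp add: lp_norm_def powr_powr lp_space_def suminf_nonneg)

lemma sum_le_lp_norm_powr:
  assumes "1 \<le> p" "x \<in> lp_space p"
  shows "(\<Sum>k<n. norm (x k) powr p) \<le> lp_norm p x powr p"
  using assms by (auto simp: lp_norm_powr lp_space_def intro: sum_le_suminf)

text \<open>Bounded partial sums of nonnegative terms yield both summability and the bound on the
  sum. Minkowski's inequality and coordinatewise limits thereby reduce to finite sums.\<close>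

lemma lp_ballI:
  fixes x :: "nat \<Rightarrow> 'a :: real_normed_vector"
  assumes p: "1 \<le> p" and B: "0 \<le> B" and le: "\<And>n. (\<Sum>k<n. norm (x k) powr p) \<le> B powr p"
  shows "x \<in> lp_space p \<and> lp_norm p x \<le> B"
proof -
  have "summable (\<lambda>k. norm (x k) powr p)"
    using le by (intro summableI_nonneg_bounded) auto
  moreover from this have "(\<Sum>k. norm (x k) powr p) \<le> B powr p"
    using le by (intro suminf_le_const)
  then have "lp_norm p x \<le> (B powr p) powr (1 / p)"
    unfolding lp_norm_def using p \<open>summable _\<close> by (intro powr_mono2) (auto intro: suminf_nonneg)
  ultimately show ?thesis
    using p B by (simp add: lp_space_def powr_powr)
qed

lemma norm_le_lp_norm:
  assumes p: "1 \<le> p" and x: "x \<in> lp_space p"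
  shows "norm (x k) \<le> lp_norm p x"
proof -
  have "norm (x k) powr p \<le> (\<Sum>j<Suc k. norm (x j) powr p)"
    by (simp add: sum_nonneg)
  also have "\<dots> \<le> lp_norm p x powr p"
    by (rule sum_le_lp_norm_powr[OF p x])
  \<comment> \<open>The \<open>p\<close>-th root is taken by contradiction: strict monotonicity of
    \<open>powr\<close> would reverse the inequality just shown.\<close>
  finally show ?thesis
    using p powr_less_mono2[of p "lp_norm p x" "norm (x k)"] lp_norm_nonneg[of p x] by linarith
qed

section \<open>Convexity of powers and Minkowski's inequality\<close>

text \<open>Coordinates may vanish, so convexity is needed up to the endpoint 0. If one argument is
  0, then \<open>0 powr p = 0\<close> reduces the claim to the estimate \<open>scale\<close>;
  otherwise \<open>powr_convex\<close> applies.\<close>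

lemma convex_on_powr_nonneg:
  fixes p :: real
  assumes p: "1 \<le> p"
  shows "convex_on {0..} (\<lambda>t. t powr p)"
proof (rule convex_onI)
  fix t x y :: real
  assume t: "0 < t" "t < 1" and xy: "x \<in> {0..}" "y \<in> {0..}"
  have scale: "(l * z) powr p \<le> l * z powr p" if "0 < l" "l < 1" "0 \<le> z" for l z :: real
  proof -
    have "l powr p \<le> l"
      using powr_mono'[OF p, of l] that by simp
    then show ?thesis
      using that by (simp add: powr_mult mult_right_mono)
  qed
  consider "x = 0" | "y = 0" | "x > 0" "y > 0"
    using xy by force
  then show "((1 - t) *\<^sub>R x + t *\<^sub>R y) powr p \<le> (1 - t) * x powr p + t * y powr p"
  proof cases
    case 3
    then show ?thesis
      using convex_onD[OF powr_convex[OF p], of t x y] t by simp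
  qed (use scale[of t y] scale[of "1 - t" x] t xy in auto)
qed simp

text \<open>
  Jensen for \<open>t \<mapsto> t\<^sup>p\<close> at \<open>u / a\<close> and \<open>v / b\<close> with weights \<open>a / (a + b)\<close> and \<open>b / (a + b)\<close>;
  summed with \<open>a\<close>, \<open>b\<close> the \<open>\<ell>\<^sub>p\<close> norms it is Minkowski's inequality.
\<close>

lemma add_powr_le_weighted:
  fixes a b u v p :: real
  assumes p: "1 \<le> p" and a: "0 < a" and b: "0 < b" and u: "0 \<le> u" and v: "0 \<le> v"
  shows "(u + v) powr p \<le>
    (a + b) powr p * (a / (a + b) * (u powr p / a powr p) + b / (a + b) * (v powr p / b powr p))"
proof -
  \<comment> \<open>The parameter \<open>b / (a + b)\<close> weights the second point, leaving
    \<open>a / (a + b)\<close> for the first.\<close>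
  have "(a / (a + b) * (u / a) + b / (a + b) * (v / b)) powr p
      \<le> a / (a + b) * (u / a) powr p + b / (a + b) * (v / b) powr p"
    using convex_onD[OF convex_on_powr_nonneg[OF p], of "b / (a + b)" "u / a" "v / b"] a b u v
    by (simp add: field_simps)
  moreover have "a / (a + b) * (u / a) + b / (a + b) * (v / b) = (u + v) / (a + b)"
    using a b by (simp add: add_divide_distrib)
  ultimately have "((u + v) / (a + b)) powr p
      \<le> a / (a + b) * (u powr p / a powr p) + b / (a + b) * (v powr p / b powr p)"
    using a b u v by (simp add: powr_divide)
  then have "(a + b) powr p * ((u + v) / (a + b)) powr p \<le>
    (a + b) powr p * (a / (a + b) * (u powr p / a powr p) + b / (a + b) * (v powr p / b powr p))"
    by (rule mult_left_mono) simp
  moreover have "(a + b) powr p * ((u + v) / (a + b)) powr p = (u + v) powr p"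
    using a b u v by (simp add: powr_divide)
  ultimately show ?thesis by simp
qed

lemma lp_minkowski:
  fixes x y :: "nat \<Rightarrow> 'a :: real_normed_field"
  assumes p: "1 \<le> p" and x: "x \<in> lp_space p" and y: "y \<in> lp_space p"
  shows "(\<lambda>k. x k + y k) \<in> lp_space p \<and> lp_norm p (\<lambda>k. x k + y k) \<le> lp_norm p x + lp_norm p y"
proof -
  define a b where "a = lp_norm p x" and "b = lp_norm p y"
  \<comment> \<open>The weighted inequality divides by \<open>a\<close> and \<open>b\<close>; a
    vanishing norm forces a zero sequence and is treated directly.\<close>
  consider "a = 0" | "b = 0" | "0 < a" "0 < b"
    using lp_norm_nonneg[of p x] lp_norm_nonneg[of p y] unfolding a_def b_def by linarith
  then show ?thesis
  proof cases
    case 1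
    then have "x k = 0" for k
      using norm_le_lp_norm[OF p x, of k] by (simp add: a_def)
    then show ?thesis using y by (simp add: lp_norm_nonneg)
  next
    case 2
    then have "y k = 0" for k
      using norm_le_lp_norm[OF p y, of k] by (simp add: b_def)
    then show ?thesis using x by (simp add: lp_norm_nonneg)
  next
    case 3
    have "(\<Sum>k<n. norm (x k + y k) powr p) \<le> (a + b) powr p" for n
    proof -
      have "(\<Sum>k<n. norm (x k + y k) powr p)
          \<le> (\<Sum>k<n. (a + b) powr p * (a / (a + b) * (norm (x k) powr p / a powr p)
                                    + b / (a + b) * (norm (y k) powr p / b powr p)))"
        using 3 p
        by (intro sum_mono order_trans[OF powr_mono2 add_powr_le_weighted] norm_triangle_ineq) auto
      also have "\<dots> = (a + b) powr p * (a / (a + b) * ((\<Sum>k<n. norm (x k) powr p) / a powr p)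
                                    + b / (a + b) * ((\<Sum>k<n. norm (y k) powr p) / b powr p))"
        by (simp only: sum_distrib_left[symmetric] sum.distrib sum_divide_distrib[symmetric])
      \<comment> \<open>Each partial sum is at most the \<open>p\<close>-th power of its norm, so
        both quotients are at most 1; the remaining weights add up to 1.\<close>
      also have "\<dots> \<le> (a + b) powr p * (a / (a + b) * 1 + b / (a + b) * 1)"
        using 3 sum_le_lp_norm_powr[OF p x, of n] sum_le_lp_norm_powr[OF p y, of n]
        by (intro mult_left_mono add_mono) (auto simp: a_def b_def)
      also have "\<dots> = (a + b) powr p"
        using 3 by (simp add: add_divide_distrib[symmetric])
      finally show ?thesis .
    qed
    then show ?thesis
      using lp_ballI[OF p, of "a + b" "\<lambda>k. x k + y k"] 3 by (simp add: a_def b_def)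
  qed
qed

section \<open>Norm axioms and closed balls in \<open>\<ell>\<^sub>p\<close>\<close>

lemma lp_scale:
  fixes x :: "nat \<Rightarrow> 'a :: real_normed_field"
  assumes p: "1 \<le> p" and x: "x \<in> lp_space p"
  shows "(\<lambda>k. c * x k) \<in> lp_space p \<and> lp_norm p (\<lambda>k. c * x k) = norm c * lp_norm p x"
proof -
  have sm: "summable (\<lambda>k. norm (x k) powr p)"
    using x by (simp add: lp_space_def)
  have eq: "norm (c * x k) powr p = norm c powr p * norm (x k) powr p" for k
    by (simp add: norm_mult powr_mult)
  show ?thesis
    using sm p by (simp add: lp_space_def lp_norm_def eq summable_mult suminf_mult
        powr_mult powr_powr suminf_nonneg)
qed

lemma zero_in_lp_space: "(\<lambda>k. 0) \<in> lp_space p"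
  by (simp add: lp_space_def)

lemma seq_subspace_lp: "1 \<le> p \<Longrightarrow> seq_subspace (lp_space p)"
  unfolding seq_subspace_def by (simp add: zero_in_lp_space lp_minkowski lp_scale)

lemma seq_norm_on_lp:
  assumes p: "1 \<le> p"
  shows "seq_norm_on (lp_space p :: (nat \<Rightarrow> 'a :: real_normed_field) set) (lp_norm p)"
proof -
  have "lp_norm p x = 0 \<longleftrightarrow> x = (\<lambda>k. 0)" if "x \<in> lp_space p" for x :: "nat \<Rightarrow> 'a"
    using norm_le_lp_norm[OF p that] by (auto simp: lp_norm_def fun_eq_iff)
  then show ?thesis
    unfolding seq_norm_on_def by (simp add: lp_norm_nonneg lp_minkowski lp_scale p)
qed

lemma bounded_coords_lp: "1 \<le> p \<Longrightarrow> bounded_coords (lp_space p) (lp_norm p)"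
  unfolding bounded_coords_def by (intro allI exI[of _ 1]) (simp add: norm_le_lp_norm)

text \<open>For a fixed length \<open>m\<close> the partial sums are continuous in finitely many
  coordinates, so the bound \<open>B powr p\<close> survives the limit in \<open>n\<close>;
  \<open>lp_ballI\<close> then handles all \<open>m\<close> at once.\<close>

lemma balls_coordwise_closed_lp:
  assumes p: "1 \<le> p"
  shows "balls_coordwise_closed (lp_space p) (lp_norm p)"
  unfolding balls_coordwise_closed_def
proof (intro allI impI)
  fix f and x :: "nat \<Rightarrow> 'a" and B
  assume f: "\<forall>n. f n \<in> lp_space p \<and> lp_norm p (f n) \<le> B"
    and x: "\<forall>k. (\<lambda>n. f n k) \<longlonglongrightarrow> x k"
  have B: "0 \<le> B"
    using f lp_norm_nonneg[of p "f 0"] by (meson order_trans)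
  have "(\<Sum>k<m. norm (x k) powr p) \<le> B powr p" for m
  proof (rule LIMSEQ_le_const2)
    show "(\<lambda>n. \<Sum>k<m. norm (f n k) powr p) \<longlonglongrightarrow> (\<Sum>k<m. norm (x k) powr p)"
      \<comment> \<open>The variant \<open>tendsto_powr'\<close> also covers limits
        \<open>x k = 0\<close>, since the exponent is positive.\<close>
      using x p by (intro tendsto_sum tendsto_powr' tendsto_norm tendsto_const) auto
    have "(\<Sum>k<m. norm (f n k) powr p) \<le> B powr p" for n
    proof -
      have "(\<Sum>k<m. norm (f n k) powr p) \<le> lp_norm p (f n) powr p"
        using f p by (intro sum_le_lp_norm_powr) auto
      also have "\<dots> \<le> B powr p"
        using f p by (intro powr_mono2) (auto simp: lp_norm_nonneg)
      finally show ?thesis .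
    qed
    then show "\<exists>N. \<forall>n\<ge>N. (\<Sum>k<m. norm (f n k) powr p) \<le> B powr p" by blast
  qed
  then show "x \<in> lp_space p \<and> lp_norm p x \<le> B"
    by (rule lp_ballI[OF p B])
qed

theorem theorem3p1:
  fixes \<tau> :: real
  assumes "\<tau> \<notin> \<int>\<^sub>\<le>\<^sub>0"
  shows "(\<forall>p::real. 1 \<le> p \<longrightarrow>
            BK_space (matrix_domain (P_hat \<tau>)
                        (lp_space p :: (nat \<Rightarrow> 'a :: {real_normed_field, banach}) set))
                     (\<lambda>x. lp_norm p (tri_apply (P_hat \<tau>) x))) \<and>
         BK_space (matrix_domain (P_hat \<tau>)
                     (linf_space :: (nat \<Rightarrow> 'a) set))
                  (\<lambda>x. linf_norm (tri_apply (P_hat \<tau>) x))"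
proof (intro conjI allI impI)
  show "BK_space (matrix_domain (P_hat \<tau>) (lp_space p :: (nat \<Rightarrow> 'a) set))
      (\<lambda>x. lp_norm p (tri_apply (P_hat \<tau>) x))" if "1 \<le> p" for p
    using that by (intro BK_space_matrix_domain seq_subspace_lp seq_norm_on_lp
        bounded_coords_lp balls_coordwise_closed_lp) (simp_all add: P_hat_diag)
  show "BK_space (matrix_domain (P_hat \<tau>) (linf_space :: (nat \<Rightarrow> 'a) set))
      (\<lambda>x. linf_norm (tri_apply (P_hat \<tau>) x))"
    by (intro BK_space_matrix_domain seq_subspace_linf seq_norm_on_linf
        bounded_coords_linf balls_coordwise_closed_linf) (simp add: P_hat_diag)
qed

end
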